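(* Let $X=[\ell,u]\subseteq\mathbb{R}^n$ be a box with $\ell_i<u_i$ for all $i$, and let $g:\mathbb{R}^n\to\mathbb{R}$ and $h:\mathbb{R}^n\to\mathbb{R}$ be convex functions. Let $x^*$ be a global minimizer of $\min_{x\in X}(g(x)-h(x))$ and $z^*=g(x^* )-h(x^* )$. Then Algorithm 3 (defined in the context) stops after finitely many iterations when $\epsilon$ is set to a positive number $\tilde\epsilon$.
   Context: $X=\{x\in\mathbb{R}^n\mid \ell_i\le x_i\le u_i,\ i=1,\dots,n\}$ with $\ell_i<u_i$ for all $i$. For $x\in\mathbb{R}^n$, $c(x)$ denotes an (arbitrary, chosen) element of the subdifferential $\partial g(x)$, and for $x^*\in\mathbb{R}^n$, $$H(g,x^* )=\{(x,t)\in\mathbb{R}^n\times\mathbb{R}\mid t-c(x^* )^{\mathsf T}x\ge g(x^* )-c(x^* )^{\mathsf T}x^*\}.$$ $\operatorname{vert} C$ denotes the set of vertices of a polyhedral convex set $C$. Algorithm 3 (input $g,h$, $X=[\ell,u]$, $\epsilon$): Set $k=0$, $x^0=\frac{\ell+u}{2}$, $\bar C^0=H(g,x^0)\cap(X\times\mathbb{R})$, $g^0(x)=g(x^0)+c(x^0)^{\mathsf T}(x-x^0)$. Repeat: increase $k$ by $1$; compute $\operatorname{vert}\bar C^{k-1}$ and choose $(x^k,y^k)\in\arg\min_{(x,y)\in\operatorname{vert}\bar C^{k-1}}(y-h(x))$. If $g(x^k)-y^k>\epsilon$, set $s^k(x)=g(x^k)+c(x^k)^{\mathsf T}(x-x^k)$,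 $g^k(x)=\max\{g^{k-1}(x),s^k(x)\}$, $\bar C^k=\bar C^{k-1}\cap H(g,x^k)$; otherwise stop and return $x^k$. *)

theory Defs
  imports "HOL-Analysis.Analysis"
begin

definition subdifferential :: "(real^'n \<Rightarrow> real) \<Rightarrow> real^'n \<Rightarrow> (real^'n) set" where
  "subdifferential g x = {p. \<forall>y. g y \<ge> g x + p \<bullet> (y - x)}"

text \<open>In what follows, \<open>c\<close> is the chosen selection of subgradients: \<open>c x\<close> is an element
  of the subdifferential of \<open>g\<close> at \<open>x\<close>.\<close>

definition H :: "(real^'n \<Rightarrow> real^'n) \<Rightarrow> (real^'n \<Rightarrow> real) \<Rightarrow> real^'n \<Rightarrow> ((real^'n) \<times> real) set" where
  "H c g xs = {(x, t). t - c xs \<bullet> x \<ge> g xs - c xs \<bullet> xs}"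

text \<open>For a polyhedral convex set, the vertices (zero-dimensional faces) are exactly the extreme
  points.\<close>

definition vert :: "'a::real_vector set \<Rightarrow> 'a set" where
  "vert C = {v. v extreme_point_of C}"

text \<open>\<open>Running C G\<close> is the state of the algorithm after some number \<open>k\<close> of completed
  iterations, with \<open>C\<close> the current outer approximation of the epigraph of \<open>g\<close> over the box and
  \<open>G\<close> the current piecewise affine minorant of \<open>g\<close>. \<open>Returned x\<close> means that the algorithm has
  stopped with output \<open>x\<close>.\<close>

datatype 'v state = Running "('v \<times> real) set" "'v \<Rightarrow> real" | Returned 'v

definition init ::
  "(real^'n \<Rightarrow> real^'n) \<Rightarrow> (real^'n \<Rightarrow> real) \<Rightarrow> real^'n \<Rightarrow> real^'n \<Rightarrow> (real^'n) state" where
  "init c g l u =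
    (let x0 = midpoint l u
     in Running (H c g x0 \<inter> (cbox l u \<times> UNIV)) (\<lambda>x. g x0 + c x0 \<bullet> (x - x0)))"

text \<open>One pass through the loop. The relation is nondeterministic because any minimizing vertex
  may be chosen.\<close>

inductive iteration ::
  "(real^'n \<Rightarrow> real^'n) \<Rightarrow> (real^'n \<Rightarrow> real) \<Rightarrow> (real^'n \<Rightarrow> real) \<Rightarrow> real
    \<Rightarrow> (real^'n) state \<Rightarrow> (real^'n) state \<Rightarrow> bool"
  for c g h \<epsilon> where
  refine: "is_arg_min (\<lambda>(x, y). y - h x) (\<lambda>v. v \<in> vert C) (xk, yk) \<Longrightarrow> g xk - yk > \<epsilon> \<Longrightarrow>
    iteration c g h \<epsilon> (Running C G)
      (Running (C \<inter> H c g xk) (\<lambda>x. max (G x) (g xk + c xk \<bullet> (x - xk))))"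
| stop: "is_arg_min (\<lambda>(x, y). y - h x) (\<lambda>v. v \<in> vert C) (xk, yk) \<Longrightarrow> \<not> g xk - yk > \<epsilon> \<Longrightarrow>
    iteration c g h \<epsilon> (Running C G) (Returned xk)"

text \<open>Whatever choices are made, the execution from \<open>s\<close> is finite and ends in a \<open>Returned\<close>
  state. The second conjunct excludes executions that get stuck in a \<open>Running\<close> state because
  there is no minimizing vertex to choose.\<close>

definition stops_finitely :: "('v state \<Rightarrow> 'v state \<Rightarrow> bool) \<Rightarrow> 'v state \<Rightarrow> bool" where
  "stops_finitely R s \<longleftrightarrow>
    \<not> (\<exists>\<sigma>. \<sigma> (0::nat) = s \<and> (\<forall>k. R (\<sigma> k) (\<sigma> (Suc k)))) \<and>
    (\<forall>s'. R\<^sup>*\<^sup>* s s' \<and> \<not> (\<exists>t. R s' t) \<longrightarrow> (\<exists>x. s' = Returned x))"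

end

theory Submission imports Defs begin

text \<open>
  Two things have to be shown: no execution goes on forever, and no execution gets stuck for want
  of a minimizing vertex.

  \<^emph>\<open>No infinite execution.\<close> Each refinement step cuts off the chosen vertex: it adds the tangent
  inequality of \<open>g\<close> at \<open>x\<^sup>k\<close>, whereas \<open>g(x\<^sup>k) - y\<^sup>k > \<epsilon>\<close>. Since a later vertex satisfies all earlier
  inequalities, every linearization of \<open>g\<close> at an earlier point \<open>x\<^sup>j\<close> falls short of \<open>g\<close> by more than
  \<open>\<epsilon>\<close> at the later point \<open>x\<^sup>k\<close>. But \<open>g\<close> is continuous, and its subgradients are bounded on the
  compact box, so the shortfall is small as soon as \<open>x\<^sup>j\<close> and \<open>x\<^sup>k\<close> are close, which happens for some
  \<open>j < k\<close> in any sequence in a compact set (lemma \<open>linearization_gap_small\<close>).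

  \<^emph>\<open>No stuck execution.\<close> Every outer approximation is a polyhedron, so it has finitely many
  vertices and only the existence of one is at stake. The approximation contains the graph of \<open>g\<close>
  over the box, lies above the box, and is bounded below in the vertical direction by its very first
  tangent inequality. Hence its lowest points form a nonempty compact face, and an extreme point of
  that face is a vertex (lemma \<open>extreme_point_exists_if_bounded_below\<close>).
\<close>

section \<open>Linearizations of a convex function on a compact set\<close>

text \<open>Moving from \<open>x\<close> by a unit step along the subgradient \<open>p\<close> raises \<open>g\<close> by at least \<open>norm p\<close>,
  and on the compact unit neighbourhood of \<open>K\<close> the continuous function \<open>g\<close> is bounded.\<close>

lemma subgradients_bounded_on_compact:
  fixes g :: "real^'n \<Rightarrow> real"
  assumes "continuous_on UNIV g" and "compact K"
  obtains B where "\<And>x p. x \<in> K \<Longrightarrow> p \<in> subdifferential g x \<Longrightarrow> norm p \<le> B"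
proof -
  let ?N = "{x + d | x d. x \<in> K \<and> d \<in> cball 0 1}"
  have "compact ?N"
    using assms(2) compact_cball by (rule compact_sums)
  then have "bounded (g ` ?N)"
    by (intro compact_imp_bounded compact_continuous_image continuous_on_subset[OF assms(1)]) auto
  then obtain M where M: "\<And>y. y \<in> ?N \<Longrightarrow> \<bar>g y\<bar> \<le> M"
    unfolding bounded_iff real_norm_def by blast
  have "norm p \<le> 2 * M" if "x \<in> K" "p \<in> subdifferential g x" for x p
  proof -
    have "x + sgn p \<in> ?N" "x + 0 \<in> ?N"
      using that(1) by (force simp: norm_sgn)+
    then have "\<bar>g (x + sgn p)\<bar> \<le> M" "\<bar>g x\<bar> \<le> M"
      using M[of "x + sgn p"] M[of "x + 0"] by (simp_all only: add_0_right)
    moreover have "g x + p \<bullet> sgn p \<le> g (x + sgn p)"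
      using that(2) unfolding subdifferential_def by (auto dest: spec[of _ "x + sgn p"])
    moreover have "p \<bullet> sgn p = norm p"
      by (cases "p = 0") (simp_all add: sgn_div_norm dot_square_norm power2_eq_square)
    ultimately show ?thesis by linarith
  qed
  then show thesis by (rule that)
qed

text \<open>Along a convergent subsequence, both \<open>g (x k) - g (x j)\<close> and, by boundedness of the slopes,
  the linear correction \<open>c (x j) \<bullet> (x k - x j)\<close> become arbitrarily small.\<close>

lemma linearization_gap_small:
  fixes g :: "real^'n \<Rightarrow> real" and x :: "nat \<Rightarrow> real^'n"
  assumes cont: "continuous_on UNIV g" and K: "compact K" "\<And>k. x k \<in> K"
    and c: "\<And>x. c x \<in> subdifferential g x" and "\<epsilon> > 0"
  obtains j k where "j < k" "g (x k) - (g (x j) + c (x j) \<bullet> (x k - x j)) \<le> \<epsilon>"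
proof -
  obtain B where B: "\<And>x p. x \<in> K \<Longrightarrow> p \<in> subdifferential g x \<Longrightarrow> norm p \<le> B"
    using subgradients_bounded_on_compact[OF cont K(1)] by blast
  obtain a r where r: "strict_mono r" and lim: "(x \<circ> r) \<longlonglongrightarrow> a"
    using K unfolding compact_def by metis
  have slope: "norm (c (x j)) \<le> B" for j
    using B K(2) c by blast
  let ?y = "x \<circ> r"
  let ?bound = "\<lambda>n. (g (?y (Suc n)) - g (?y n)) + B * norm (?y (Suc n) - ?y n)"
  have lim': "(\<lambda>n. ?y (Suc n)) \<longlonglongrightarrow> a"
    using LIMSEQ_Suc[OF lim] .
  have "isCont g a"
    using cont by (simp add: continuous_on_eq_continuous_at)
  then have "(\<lambda>n. g (?y (Suc n))) \<longlonglongrightarrow> g a" "(\<lambda>n. g (?y n)) \<longlonglongrightarrow> g a"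
    using isCont_tendsto_compose lim lim' by blast+
  then have "?bound \<longlonglongrightarrow> (g a - g a) + B * norm (a - a)"
    using lim lim' by (intro tendsto_intros)
  then have "?bound \<longlonglongrightarrow> 0" by simp
  then have "\<forall>\<^sub>F n in sequentially. ?bound n < \<epsilon>"
    using \<open>\<epsilon> > 0\<close> by (rule order_tendstoD)
  then obtain n where n: "?bound n < \<epsilon>"
    using eventually_happens trivial_limit_sequentially by blast
  define d where "d = x (r (Suc n)) - x (r n)"
  have "\<bar>c (x (r n)) \<bullet> d\<bar> \<le> norm (c (x (r n))) * norm d"
    by (rule Cauchy_Schwarz_ineq2)
  also have "\<dots> \<le> B * norm d"
    by (intro mult_right_mono slope norm_ge_zero)
  finally have "g (x (r (Suc n))) - (g (x (r n)) + c (x (r n)) \<bullet> d) \<le> \<epsilon>"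
    using n by (simp add: d_def)
  then show thesis
    using that[of "r n" "r (Suc n)"] r unfolding d_def by (simp add: strict_mono_Suc_iff)
qed

section \<open>Vertices of the outer approximations\<close>

lemma H_eq_halfspace: "H c g x = {p. (- c x, 1) \<bullet> p \<ge> g x - c x \<bullet> x}"
  by (auto simp: H_def)

lemma mem_H_iff: "(y, t) \<in> H c g x \<longleftrightarrow> g x + c x \<bullet> (y - x) \<le> t"
  by (auto simp: H_def inner_diff_right)

lemma polyhedron_H: "polyhedron (H c g x)"
  unfolding H_eq_halfspace by (rule polyhedron_halfspace_ge)

lemma polyhedron_cbox_times_UNIV:
  fixes l u :: "'a::euclidean_space"
  shows "polyhedron (cbox l u \<times> (UNIV :: 'b::euclidean_space set))"
proof -
  have "cbox l u \<times> (UNIV :: 'b set) =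
      (\<Inter>i\<in>Basis. {p. (i, 0) \<bullet> p \<ge> l \<bullet> i} \<inter> {p. (i, 0) \<bullet> p \<le> u \<bullet> i})"
    by (auto simp: mem_box inner_commute)
  also have "polyhedron \<dots>"
    by (intro polyhedron_Inter finite_imageI finite_Basis, elim imageE, hypsubst)
      (intro polyhedron_Int polyhedron_halfspace_ge polyhedron_halfspace_le)
  finally show ?thesis .
qed

text \<open>The sublevel sets of the height \<open>snd\<close> are compact, so the height attains its minimum on \<open>C\<close>.
  The minimizers form a compact face, whose extreme points are extreme points of \<open>C\<close>.\<close>

lemma extreme_point_exists_if_bounded_below:
  fixes C :: "('a::euclidean_space \<times> real) set"
  assumes "closed C" "convex C" "C \<noteq> {}" and K: "compact K" "C \<subseteq> K \<times> UNIV"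
    and low: "\<And>p. p \<in> C \<Longrightarrow> m \<le> snd p"
  obtains v where "v extreme_point_of C"
proof -
  obtain q where q: "q \<in> C" using \<open>C \<noteq> {}\<close> by blast
  let ?S = "C \<inter> (K \<times> {m..snd q})"
  have "compact ?S"
    using \<open>closed C\<close> K(1) by (intro closed_Int_compact compact_Times compact_Icc)
  moreover have "q \<in> ?S" using q K(2) low by (auto simp: mem_Times_iff)
  ultimately obtain p where p: "p \<in> ?S" "\<And>p'. p' \<in> ?S \<Longrightarrow> snd p \<le> snd p'"
    using continuous_attains_inf[of ?S snd] continuous_on_snd[OF continuous_on_id] by blast
  have min: "snd p \<le> snd p'" if "p' \<in> C" for p'
  proof (cases "snd p' \<le> snd q")
    case True
    then show ?thesis using p(2) that K(2) low by (auto simp: mem_Times_iff)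
  next
    case False
    then show ?thesis using p(1) by (auto simp: mem_Times_iff)
  qed
  let ?F = "C \<inter> {p'. (0, 1) \<bullet> p' = snd p}"
  have face: "?F face_of C"
    using \<open>convex C\<close> by (rule face_of_Int_supporting_hyperplane_ge) (auto simp: inner_prod_def min)
  have "?F = C \<inter> (K \<times> {snd p})"
    using K(2) by (auto simp: inner_prod_def)
  then have "compact ?F"
    using \<open>closed C\<close> K(1) by (simp add: closed_Int_compact compact_Times)
  moreover have "p \<in> ?F" using p(1) by (auto simp: inner_prod_def)
  ultimately obtain v where "v extreme_point_of ?F"
    using extreme_point_exists_convex face_of_imp_convex[OF face] by blast
  then show thesis
    using that extreme_point_of_face[OF face] by blast
qed

text \<open>This is the loop invariant of the algorithm. The last conjunct is inherited from the first
  tangent inequality; without it there might be no vertex.\<close>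

definition outer_approximation ::
  "(real^'n \<Rightarrow> real) \<Rightarrow> real^'n \<Rightarrow> real^'n \<Rightarrow> ((real^'n) \<times> real) set \<Rightarrow> bool" where
  "outer_approximation g l u C \<longleftrightarrow>
    polyhedron C \<and> (\<forall>x\<in>cbox l u. (x, g x) \<in> C) \<and> C \<subseteq> cbox l u \<times> UNIV \<and>
    (\<exists>m. \<forall>p\<in>C. m \<le> snd p)"

lemma outer_approximation_init:
  assumes c: "\<And>x. c x \<in> subdifferential g x"
  shows "outer_approximation g l u (H c g x0 \<inter> (cbox l u \<times> UNIV))"
proof -
  have "continuous_on (cbox l u) (\<lambda>x. c x0 \<bullet> (x - x0))"
    by (intro continuous_intros)
  then have "bounded ((\<lambda>x. c x0 \<bullet> (x - x0)) ` cbox l u)"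
    by (intro compact_imp_bounded compact_continuous_image compact_cbox)
  then obtain M where M: "\<And>x. x \<in> cbox l u \<Longrightarrow> \<bar>c x0 \<bullet> (x - x0)\<bar> \<le> M"
    unfolding bounded_iff by auto
  have "g x0 - M \<le> snd p" if "p \<in> H c g x0 \<inter> (cbox l u \<times> UNIV)" for p
    using that M[of "fst p"] by (cases p) (auto simp: mem_H_iff abs_le_iff)
  then show ?thesis
    using c unfolding outer_approximation_def
    by (auto simp: polyhedron_H polyhedron_cbox_times_UNIV mem_H_iff subdifferential_def)
qed

lemma outer_approximation_refine:
  assumes "\<And>x. c x \<in> subdifferential g x" "outer_approximation g l u C"
  shows "outer_approximation g l u (C \<inter> H c g x)"
  using assms unfolding outer_approximation_def
  by (auto simp: polyhedron_H mem_H_iff subdifferential_def)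

lemma outer_approximation_reachable:
  assumes c: "\<And>x. c x \<in> subdifferential g x"
    and "(iteration c g h \<epsilon>)\<^sup>*\<^sup>* (init c g l u) (Running C G)"
  shows "outer_approximation g l u C"
  using assms(2)
proof (induction "Running C G" arbitrary: C G rule: rtranclp_induct)
  case base
  then show ?case
    using outer_approximation_init[OF c] by (auto simp: init_def Let_def)
next
  case (step s)
  from step.hyps(2) obtain C' G' xk where "s = Running C' G'" "C = C' \<inter> H c g xk"
    by (cases rule: iteration.cases) auto
  with step.hyps(3) show ?case
    using outer_approximation_refine[OF c] by blast
qed

lemma minimizing_vertex_exists:
  fixes f :: "(real^'n) \<times> real \<Rightarrow> real"
  assumes "outer_approximation g l u C" and "cbox l u \<noteq> {}"
  obtains v where "is_arg_min f (\<lambda>v. v \<in> vert C) v"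
proof -
  from assms obtain m where C: "polyhedron C" "C \<noteq> {}" "C \<subseteq> cbox l u \<times> UNIV"
      "\<And>p. p \<in> C \<Longrightarrow> m \<le> snd p"
    unfolding outer_approximation_def by blast
  then obtain v where "v extreme_point_of C"
    using extreme_point_exists_if_bounded_below[OF polyhedron_imp_closed polyhedron_imp_convex]
      compact_cbox by metis
  then have "vert C \<noteq> {}" "finite (vert C)"
    using finite_polyhedron_extreme_points[OF C(1)] unfolding vert_def by blast+
  then show thesis
    using that ex_is_arg_min_if_finite by blast
qed

section \<open>Termination\<close>

lemma iteration_never_stuck:
  assumes "outer_approximation g l u C" and "cbox l u \<noteq> {}"
  shows "\<exists>t. iteration c g h \<epsilon> (Running C G) t"
proof -
  obtain xk yk where "is_arg_min (\<lambda>(x, y). y - h x) (\<lambda>v. v \<in> vert C) (xk, yk)"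
    using minimizing_vertex_exists[OF assms] by (metis surj_pair)
  then show ?thesis
    by (cases "g xk - yk > \<epsilon>") (blast intro: iteration.refine iteration.stop)+
qed

text \<open>An infinite execution only refines, and the approximations decrease, so its \<open>k\<close>-th vertex
  lies above all earlier tangents although it lies more than \<open>\<epsilon>\<close> below the graph of \<open>g\<close>.\<close>

lemma no_infinite_execution:
  fixes g h :: "real^'n \<Rightarrow> real"
  assumes cont: "continuous_on UNIV g" and c: "\<And>x. c x \<in> subdifferential g x" and "\<epsilon> > 0"
    and start: "\<sigma> 0 = init c g l u" and run: "\<And>k. iteration c g h \<epsilon> (\<sigma> k) (\<sigma> (Suc k))"
  shows False
proof -
  have "\<exists>D x y. (\<exists>G. \<sigma> k = Running D G) \<and> (\<exists>G. \<sigma> (Suc k) = Running (D \<inter> H c g x) G) \<and>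
      (x, y) \<in> vert D \<and> g x - y > \<epsilon>" for k
    using run[of k]
  proof (cases rule: iteration.cases)
    case (refine xk yk C G)
    then show ?thesis unfolding is_arg_min_def by blast
  next
    \<comment> \<open>A returned state has no successor.\<close>
    case stop
    then show ?thesis using run[of "Suc k"] by (auto elim: iteration.cases)
  qed
  then obtain D x y where D: "\<And>k. \<exists>G. \<sigma> k = Running (D k) G"
    and Suc: "\<And>k. \<exists>G. \<sigma> (Suc k) = Running (D k \<inter> H c g (x k)) G"
    and vertex: "\<And>k. (x k, y k) \<in> vert (D k)" and gap: "\<And>k. g (x k) - y k > \<epsilon>"
    by metis
  have D_Suc: "D (Suc k) = D k \<inter> H c g (x k)" for k
    using D[of "Suc k"] Suc[of k] by auto
  then have dec: "D k \<subseteq> D j" if "j \<le> k" for j k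
    using lift_Suc_antimono_le[of D] that by blast
  have mem: "(x k, y k) \<in> D k" for k
    using vertex by (auto simp: vert_def extreme_point_of_def)
  have "D 0 \<subseteq> cbox l u \<times> UNIV"
    using D[of 0] start by (auto simp: init_def Let_def)
  then have "x k \<in> cbox l u" for k
    using mem dec[of 0 k] by blast
  then obtain j k where "j < k" and small: "g (x k) - (g (x j) + c (x j) \<bullet> (x k - x j)) \<le> \<epsilon>"
    using linearization_gap_small[OF cont compact_cbox _ c \<open>\<epsilon> > 0\<close>] by metis
  have "(x k, y k) \<in> H c g (x j)"
    using mem[of k] dec[of "Suc j" k] \<open>j < k\<close> D_Suc[of j] by auto
  then show False
    using small gap[of k] by (simp add: mem_H_iff)
qed

theorem corollary4p5:
  fixes l u :: "real^'n" and g h :: "real^'n \<Rightarrow> real" and c :: "real^'n \<Rightarrow> real^'n"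
    and xstar :: "real^'n" and zstar \<epsilon> :: real
  assumes "\<And>i. l $ i < u $ i"
    and "convex_on UNIV g"
    and "convex_on UNIV h"
    and "\<And>x. c x \<in> subdifferential g x"
    and "is_arg_min (\<lambda>x. g x - h x) (\<lambda>x. x \<in> cbox l u) xstar"
    and "zstar = g xstar - h xstar"
    and "\<epsilon> > 0"
  shows "stops_finitely (iteration c g h \<epsilon>) (init c g l u)"
  unfolding stops_finitely_def
proof (intro conjI allI impI)
  have "continuous_on UNIV g"
    using assms(2) by (intro convex_on_continuous open_UNIV)
  then show "\<not> (\<exists>\<sigma>. \<sigma> 0 = init c g l u \<and> (\<forall>k. iteration c g h \<epsilon> (\<sigma> k) (\<sigma> (Suc k))))"
    using no_infinite_execution[OF _ assms(4,7)] by blast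
next
  fix s
  assume s: "(iteration c g h \<epsilon>)\<^sup>*\<^sup>* (init c g l u) s \<and> \<not> (\<exists>t. iteration c g h \<epsilon> s t)"
  have "cbox l u \<noteq> {}"
    using assms(5) by (auto simp: is_arg_min_def)
  then show "\<exists>x. s = Returned x"
    using s outer_approximation_reachable[OF assms(4)] iteration_never_stuck by (cases s) blast+
qed

end
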